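(* Let $M=(E,G)$ be a full-rank, $r$-dimensional claw-free matroid. Then $|E|\ge 2^{\lfloor r/2\rfloor}+2^{\lceil r/2\rceil}-2$. Equality holds precisely when either $M$ is isomorphic to $C_4$, or $E$ is the disjoint union of two flats of $G$ of dimensions $\lfloor r/2\rfloor$ and $\lceil r/2\rceil$.
   Context: A matroid is a pair $M=(E,G)$ where $G$ is the set of nonzero vectors of a finite-dimensional $\mathbb F_2$-vector space $V(G)=G\cup\{0\}\cong\mathbb F_2^r$ and $E\subseteq G$; $r$ is the dimension of $M$. Isomorphism: a linear isomorphism of ambient spaces mapping ground sets onto each other. A flat of $G$ is a set $F\subseteq G$ with $F\cup\{0\}$ a subspace; its dimension is that of the subspace. $M$ is full-rank if $E$ spans $V(G)$. $M|F=(E\cap F,F)$. A claw is $(B,G)$ with $\dim G=3$, $B$ a basis; $M$ is claw-free if no induced restriction $M|F$ is isomorphic to a claw. $C_4$ is the $3$-dimensional matroid whose ground set consists of four elements summing to zero (e.g. $e_1,e_2,e_3,e_1+e_2+e_3$ in $\mathbb F_2^3$). *)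

theory Defs
  imports "HOL-Library.Z2" "HOL-Analysis.Cartesian_Space"
begin

text \<open>
  \<^typ>\<open>bit\<close> is the field with two elements.  The space \<open>V(G) = G \<union> {0}\<close> is a
  finite-dimensional subspace of an arbitrary \<^typ>\<open>bit\<close>-vector space given by its scalar
  multiplication (called \<open>smul\<close> below); thus restrictions to flats are again matroids over the
  same type, and dimension 0 is included.
\<close>

type_synonym 'v matroid = "'v set \<times> 'v set"

fun is_matroid :: "(bit \<Rightarrow> 'v \<Rightarrow> 'v) \<Rightarrow> 'v::ab_group_add matroid \<Rightarrow> bool" where
  "is_matroid smul (E, G) \<longleftrightarrow>
     0 \<notin> G \<and> module.subspace smul (G \<union> {0}) \<and>
     (\<exists>S. finite S \<and> module.span smul S = G \<union> {0}) \<and>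
     E \<subseteq> G"

definition is_flat :: "(bit \<Rightarrow> 'v \<Rightarrow> 'v) \<Rightarrow> 'v::ab_group_add set \<Rightarrow> 'v set \<Rightarrow> bool" where
  "is_flat smul G F \<longleftrightarrow> F \<subseteq> G \<and> module.subspace smul (F \<union> {0})"

definition flat_dim :: "(bit \<Rightarrow> 'v \<Rightarrow> 'v) \<Rightarrow> 'v::ab_group_add set \<Rightarrow> nat" where
  "flat_dim smul F = vector_space.dim smul (F \<union> {0})"

fun matroid_dim :: "(bit \<Rightarrow> 'v \<Rightarrow> 'v) \<Rightarrow> 'v::ab_group_add matroid \<Rightarrow> nat" where
  "matroid_dim smul (E, G) = flat_dim smul G"

fun full_rank :: "(bit \<Rightarrow> 'v \<Rightarrow> 'v) \<Rightarrow> 'v::ab_group_add matroid \<Rightarrow> bool" where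
  "full_rank smul (E, G) \<longleftrightarrow> module.span smul E = G \<union> {0}"

fun restriction :: "'v matroid \<Rightarrow> 'v set \<Rightarrow> 'v matroid" where
  "restriction (E, G) F = (E \<inter> F, F)"

definition linear_iso_on ::
  "(bit \<Rightarrow> 'v \<Rightarrow> 'v) \<Rightarrow> (bit \<Rightarrow> 'w \<Rightarrow> 'w) \<Rightarrow>
     'v::ab_group_add set \<Rightarrow> 'w::ab_group_add set \<Rightarrow> ('v \<Rightarrow> 'w) \<Rightarrow> bool" where
  "linear_iso_on smul smul' V W f \<longleftrightarrow>
     bij_betw f V W \<and>
     (\<forall>x\<in>V. \<forall>y\<in>V. f (x + y) = f x + f y) \<and>
     (\<forall>c. \<forall>x\<in>V. f (smul c x) = smul' c (f x))"

fun isomorphic ::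
  "(bit \<Rightarrow> 'v \<Rightarrow> 'v) \<Rightarrow> (bit \<Rightarrow> 'w \<Rightarrow> 'w) \<Rightarrow>
     'v::ab_group_add matroid \<Rightarrow> 'w::ab_group_add matroid \<Rightarrow> bool" where
  "isomorphic smul smul' (E, G) (E', G') \<longleftrightarrow>
     (\<exists>f. linear_iso_on smul smul' (G \<union> {0}) (G' \<union> {0}) f \<and> f ` E = E')"

fun is_claw :: "(bit \<Rightarrow> 'v \<Rightarrow> 'v) \<Rightarrow> 'v::ab_group_add matroid \<Rightarrow> bool" where
  "is_claw smul (B, G) \<longleftrightarrow>
     is_matroid smul (B, G) \<and> flat_dim smul G = 3 \<and>
     \<not> module.dependent smul B \<and> module.span smul B = G \<union> {0}"

text \<open>
  The claw ranges over the type of the matroid itself.  This loses nothing, as \<^const>\<open>is_claw\<close> is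
  invariant under isomorphism: a restriction isomorphic to a claw in another space is a claw.
\<close>

fun claw_free :: "(bit \<Rightarrow> 'v \<Rightarrow> 'v) \<Rightarrow> 'v::ab_group_add matroid \<Rightarrow> bool" where
  "claw_free smul (E, G) \<longleftrightarrow>
     \<not> (\<exists>F C. is_flat smul G F \<and> is_claw smul C \<and>
             isomorphic smul smul (restriction (E, G) F) C)"

definition C4 :: "(bit ^ 3) matroid" where
  "C4 = ({axis 1 1, axis 2 1, axis 3 1, axis 1 1 + axis 2 1 + axis 3 1}, UNIV - {0})"

end

theory Submission imports Defs begin

text \<open>
  If \<open>x\<close>, \<open>y\<close> are distinct elements of \<open>E\<close> with \<open>x + y \<notin> E\<close>, project along the span of \<open>x\<close>, \<open>y\<close>.  The
  nonzero image of \<open>E\<close> is again claw-free, of rank \<open>r - 2\<close>, and claw-freeness forces each of its fibres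
  in \<open>E\<close> to have at least two elements, so the size of \<open>E\<close> is at least twice that of the image plus 2;
  the bound follows by induction, the case where no such \<open>x\<close>, \<open>y\<close> exist being \<open>E = G\<close>.

  In the case of equality all fibres have exactly two elements.  This makes \<open>x = y \<or> x + y \<in> E\<close> a
  transitive relation on \<open>E\<close>, whose classes are flats.  With at most two classes \<open>E\<close> is a union of two
  disjoint flats, and the size determines their dimensions.  With three or more, claw-freeness makes
  all classes singletons, so \<open>E\<close> is the complement of a hyperplane and has \<open>2 ^ (r - 1)\<close> elements; this
  meets the bound with \<open>r \<ge> 3\<close> only for \<open>r = 3\<close>, which is \<open>C\<^sub>4\<close>.
\<close>

text \<open>
  Three distinct elements of \<open>E \<subseteq> G\<close> violating the condition below form a basis of a plane that
  meets \<open>E\<close> in nothing else, so this expresses claw-freeness without reference to flats.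
\<close>

definition plane_claw_free :: "'v::ab_group_add set \<Rightarrow> bool" where
  "plane_claw_free E \<longleftrightarrow> (\<forall>x\<in>E. \<forall>y\<in>E. \<forall>z\<in>E. x \<noteq> y \<longrightarrow> x \<noteq> z \<longrightarrow> y \<noteq> z \<longrightarrow>
     x + y \<in> E \<or> x + z \<in> E \<or> y + z \<in> E \<or> x + y + z \<in> E)"

section \<open>Arithmetic of the two nearly equal powers in the bound\<close>

lemma balanced_powers_step:
  "2 ^ ((n + 2) div 2) + 2 ^ ((n + 2 + 1) div 2) = 2 * (2 ^ (n div 2) + 2 ^ ((n + 1) div 2) :: nat)"
proof -
  have "(n + 2) div 2 = Suc (n div 2)" "(n + 2 + 1) div 2 = Suc ((n + 1) div 2)" by simp_all
  then show ?thesis by simp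
qed

lemma balanced_powers_mult: "2 ^ (n div 2) * 2 ^ ((n + 1) div 2) = (2 ^ n :: nat)"
proof -
  have "n div 2 + (n + 1) div 2 = n" by presburger
  then show ?thesis by (metis power_add)
qed

text \<open>With the powers written as \<open>p + 1\<close> and \<open>q + 1\<close>, their product
  is \<open>2 ^ n\<close>, and the claim reduces to \<open>p * q\<close> being nonnegative. It
  settles the end of the induction, where \<open>E\<close> consists of all nonzero vectors.\<close>

lemma balanced_powers_le: "2 ^ (n div 2) + 2 ^ ((n + 1) div 2) \<le> (2 ^ n + 1 :: nat)"
proof -
  define p q where "p = (2 ^ (n div 2) :: nat) - 1" and "q = (2 ^ ((n + 1) div 2) :: nat) - 1"
  then have pq: "2 ^ (n div 2) = p + 1" "2 ^ ((n + 1) div 2) = q + 1" by simp_all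
  show ?thesis using balanced_powers_mult[of n] unfolding pq by (simp add: algebra_simps)
qed

text \<open>Both pairs of powers have the same sum and the same product, hence are the roots of the
  same quadratic. The proof moves to the integers in order to factor it.\<close>

lemma powers_sum_balanced:
  assumes n: "a + b = n" and s: "2 ^ a + 2 ^ b = (2 ^ (n div 2) + 2 ^ ((n + 1) div 2) :: nat)"
  shows "a = n div 2 \<and> b = (n + 1) div 2 \<or> b = n div 2 \<and> a = (n + 1) div 2"
proof -
  define P Q where "P = (2 ^ (n div 2) :: int)" and "Q = (2 ^ ((n + 1) div 2) :: int)"
  define p q where "p = (2 ^ a :: int)" and "q = (2 ^ b :: int)"
  have "int (2 ^ a + 2 ^ b) = int (2 ^ (n div 2) + 2 ^ ((n + 1) div 2))" using s by simp
  then have s': "p + q = P + Q" by (simp add: P_def Q_def p_def q_def)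
  have "int (2 ^ a * 2 ^ b) = int (2 ^ (n div 2) * 2 ^ ((n + 1) div 2))"
    using n balanced_powers_mult[of n] by (metis power_add)
  then have m: "p * q = P * Q" by (simp add: P_def Q_def p_def q_def)
  have "(p - P) * (p - Q) = p * p - p * (P + Q) + P * Q" by (simp add: algebra_simps)
  also have "\<dots> = 0" unfolding s'[symmetric] m[symmetric] by (simp add: algebra_simps)
  finally have "p = P \<or> p = Q" by simp
  then have "a = n div 2 \<or> a = (n + 1) div 2" by (auto simp: p_def P_def Q_def)
  moreover have "n div 2 + (n + 1) div 2 = n" by presburger
  ultimately show ?thesis using n by linarith
qed

section \<open>Spans and their sizes over the field with two elements\<close>

locale bit_vector_space = vector_space smul for smul :: "bit \<Rightarrow> 'v::ab_group_add \<Rightarrow> 'v"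
begin

lemma add_self [simp]: "x + x = (0::'v)"
proof -
  have "x + x = smul (1 + 1) x" by (simp only: scale_left_distrib scale_one)
  then show ?thesis by simp
qed

lemma add_self_left [simp]: "x + (x + y) = (y::'v)"
  by (simp add: add.assoc[symmetric])

lemma minus_eq [simp]: "- x = (x::'v)"
  by (rule minus_unique) simp

lemma diff_eq_add [simp]: "x - y = x + (y::'v)"
  by (metis diff_conv_add_uminus minus_eq)

lemma add_eq_0_iff_eq [simp]: "x + y = 0 \<longleftrightarrow> x = (y::'v)"
  by (metis add_self add_left_cancel)

lemma add_eq_iff: "x + y = z \<longleftrightarrow> x = y + (z::'v)"
  by (metis add_self_left add.commute)

lemma subspace_bit_iff: "subspace S \<longleftrightarrow> 0 \<in> S \<and> (\<forall>x\<in>S. \<forall>y\<in>S. x + y \<in> S)"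
proof -
  have "smul c x \<in> S" if "0 \<in> S" "x \<in> S" for c x using that by (cases c) auto
  then show ?thesis unfolding subspace_def by auto
qed

lemma span_insert_bit: "span (insert a S) = span S \<union> (+) a ` span S"
proof -
  have "(\<exists>k. x - smul k a \<in> span S) \<longleftrightarrow> x \<in> span S \<or> x + a \<in> span S" for x
  proof
    assume "\<exists>k. x - smul k a \<in> span S"
    then obtain k where "x - smul k a \<in> span S" ..
    then show "x \<in> span S \<or> x + a \<in> span S" by (cases k) auto
  next
    assume "x \<in> span S \<or> x + a \<in> span S"
    then have "x - smul 0 a \<in> span S \<or> x - smul 1 a \<in> span S" by simp
    then show "\<exists>k. x - smul k a \<in> span S" by blast
  qed
  moreover have "x + a \<in> span S \<longleftrightarrow> x \<in> (+) a ` span S" for x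
    by (metis add_self_left add.commute image_iff)
  ultimately show ?thesis unfolding span_insert by auto
qed

lemma span_pair: "span {x, y} = {0, x, y, x + y}"
  by (auto simp: span_insert_bit)

lemma span_triple: "span {x, y, z} = {0, x, y, z, x + y, x + z, y + z, x + y + z}"
  by (auto simp: span_insert_bit span_pair add.assoc)

text \<open>Adjoining \<open>a\<close> outside the span adds the disjoint coset
  \<open>a + span B\<close>, which doubles the size.\<close>

lemma card_span_independent:
  assumes "finite B" "independent B"
  shows "finite (span B) \<and> card (span B) = 2 ^ card B"
  using assms
proof (induction B rule: finite_induct)
  case empty
  then show ?case by simp
next
  case (insert a B)
  then have IH: "finite (span B)" "card (span B) = 2 ^ card B" and a: "a \<notin> span B"
    by (auto simp: independent_insert)
  have disj: "span B \<inter> (+) a ` span B = {}"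
  proof -
    have "a \<in> span B" if "a + y \<in> span B" "y \<in> span B" for y
      using span_add[OF that] by (simp add: add.assoc)
    with a show ?thesis by auto
  qed
  have "card ((+) a ` span B) = card (span B)" by (rule card_image) (auto intro: inj_onI)
  with IH disj have "card (span B \<union> (+) a ` span B) = 2 * 2 ^ card B"
    by (subst card_Un_disjoint) auto
  with IH insert.hyps show ?case unfolding span_insert_bit by simp
qed

lemma card_subspace:
  assumes "subspace S" "finite S"
  shows "card S = 2 ^ dim S"
proof -
  obtain B where B: "B \<subseteq> S" "independent B" "S \<subseteq> span B" "card B = dim S"
    using basis_exists .
  have "span B = S" using B assms(1) by (simp add: span_subspace)
  moreover have "finite B" using B assms(2) finite_subset by blast
  ultimately show ?thesis using card_span_independent B by metis
qed

section \<open>Projection along the span of two elements\<close>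

lemma contraction_projection:
  assumes B: "independent B" "B \<subseteq> E" "E \<subseteq> span B" "finite E"
    and xy: "x \<in> E" "y \<in> E" "x \<noteq> y" "x \<noteq> 0" "y \<noteq> 0"
  obtains \<pi> B' where "\<And>u v. \<pi> (u + v) = \<pi> u + \<pi> v"
    "\<And>u. u \<in> span B \<Longrightarrow> \<pi> u = 0 \<longleftrightarrow> u \<in> {0, x, y, x + y}"
    "independent B'" "B' \<subseteq> \<pi> ` E - {0}" "\<pi> ` E \<subseteq> span B'" "card B = card B' + 2"
proof -
  have ind: "independent {x, y}" using xy by (auto simp: independent_insert span_insert_bit)
  \<comment> \<open>The basis is chosen inside \<open>E\<close> so that its remaining vectors, which
    \<open>\<pi>\<close> fixes, lie in the image of \<open>E\<close> and form a basis there.\<close>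
  obtain C where C: "{x, y} \<subseteq> C" "C \<subseteq> E" "independent C" "E \<subseteq> span C"
    using maximal_independent_subset_extend[of "{x, y}" E] ind xy by auto
  interpret vector_space_pair smul smul by unfold_locales
  obtain \<pi> where lin: "Vector_Spaces.linear smul smul \<pi>" and \<pi>: "\<And>u. u \<in> C \<Longrightarrow> \<pi> u = (if u = x \<or> u = y then 0 else u)"
    using linear_independent_extend[OF C(3), of "\<lambda>u. if u = x \<or> u = y then 0 else u"] by auto
  have add: "\<pi> (u + v) = \<pi> u + \<pi> v" for u v using linear_add[OF lin] .
  have z: "\<pi> 0 = 0" using linear_0[OF lin] .
  have spanBC: "span B = span C" using B C by (meson span_eq subset_trans)
  \<comment> \<open>\<open>\<pi>\<close> moves every vector by an element of
    \<open>span {x, y}\<close> only. So \<open>\<pi> u = 0\<close> puts \<open>u\<close> itself into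
    that span, without a dimension count.\<close>
  have kerx: "\<pi> u + u \<in> span {x, y}" if "u \<in> span C" for u
    using that
  proof (induction rule: span_induct_alt)
    case base
    then show ?case by (simp add: z span_zero)
  next
    case (step c a u)
    have "\<pi> a + a \<in> span {x, y}" using \<pi>[OF step(1)] by (auto simp: span_pair)
    then have "smul c (\<pi> a + a) + (\<pi> u + u) \<in> span {x, y}"
      using step(2) by (intro span_add[OF span_scale])
    moreover have "\<pi> (smul c a + u) + (smul c a + u) = smul c (\<pi> a + a) + (\<pi> u + u)"
      using linear_scale[OF lin] by (simp add: add scale_right_distrib ac_simps)
    ultimately show ?case by metis
  qed
  have ker: "\<pi> u = 0 \<longleftrightarrow> u \<in> {0, x, y, x + y}" if "u \<in> span B" for u
  proof
    assume "\<pi> u = 0"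
    then show "u \<in> {0, x, y, x + y}" using kerx[of u] that spanBC by (simp add: span_pair)
  next
    assume "u \<in> {0, x, y, x + y}"
    then show "\<pi> u = 0" using C(1) \<pi>[of x] \<pi>[of y] by (auto simp: add z)
  qed
  have "0 \<notin> C" using C(3) dependent_zero by blast
  define B' where "B' = C - {x, y}"
  have fC: "finite C" using C(2) B(4) by (rule finite_subset)
  have \<pi>B': "\<pi> u = u" if "u \<in> B'" for u using that \<pi>[of u] by (auto simp: B'_def)
  have 1: "independent B'" unfolding B'_def using C(3) by (rule independent_mono) blast
  have 2: "B' \<subseteq> \<pi> ` E - {0}"
  proof
    fix u assume u: "u \<in> B'"
    then have "\<pi> u \<in> \<pi> ` E" "u \<noteq> 0" using C(2) \<open>0 \<notin> C\<close> by (auto simp: B'_def)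
    then show "u \<in> \<pi> ` E - {0}" using \<pi>B'[OF u] by simp
  qed
  have "\<pi> ` E \<subseteq> \<pi> ` span C" using C(4) by (rule image_mono)
  also have "\<dots> = span (\<pi> ` C)" using linear_span_image[OF lin] by simp
  also have "\<dots> \<subseteq> span (insert 0 B')"
    using \<pi> by (intro span_mono) (auto simp: B'_def)
  finally have 3: "\<pi> ` E \<subseteq> span B'" by simp
  have "card B = dim (span B)" using B(1) by (simp add: dim_span_eq_card_independent del: dim_span)
  also have "\<dots> = card C" using spanBC C(3) by (simp add: dim_span_eq_card_independent del: dim_span)
  also have "\<dots> = card B' + 2"
  proof -
    have "card B' = card C - card {x, y}"
      unfolding B'_def using C fC by (intro card_Diff_subset) auto
    moreover have "card {x, y} \<le> card C" using C fC card_mono by blast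
    ultimately show ?thesis using xy by simp
  qed
  finally have 4: "card B = card B' + 2" .
  show thesis using that[OF add ker 1 2 3 4] .
qed

text \<open>The last conclusion is for the case of equality: if \<open>card E\<close> is exactly
  twice \<open>card E'\<close> plus 2, there is no slack in any fibre, and the fibre of
  \<open>z\<close> is the part of \<open>E\<close> in the coset
  \<open>z + span {x, y}\<close>.\<close>

lemma contraction:
  assumes B: "independent B" "B \<subseteq> E" "E \<subseteq> span B" "finite E"
    and E: "0 \<notin> E" "plane_claw_free E"
    and xy: "x \<in> E" "y \<in> E" "x \<noteq> y" "x + y \<notin> E"
  obtains E' B' where "independent B'" "B' \<subseteq> E'" "E' \<subseteq> span B'" "finite E'" "0 \<notin> E'"
    "plane_claw_free E'" "card B = card B' + 2" "2 * card E' + 2 \<le> card E"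
    "\<And>z. card E = 2 * card E' + 2 \<Longrightarrow> z \<in> E - {x, y} \<Longrightarrow>
       card (E \<inter> {z, z + x, z + y, z + x + y}) = 2"
proof -
  obtain \<pi> B' where add: "\<And>u v. \<pi> (u + v) = \<pi> u + \<pi> v"
    and ker: "\<And>u. u \<in> span B \<Longrightarrow> \<pi> u = 0 \<longleftrightarrow> u \<in> {0, x, y, x + y}"
    and B': "independent B'" "B' \<subseteq> \<pi> ` E - {0}" "\<pi> ` E \<subseteq> span B'" "card B = card B' + 2"
    using contraction_projection[OF B, of x y] xy E by metis
  define E' where "E' = \<pi> ` E - {0}"
  have fE': "finite E'" using B by (simp add: E'_def)
  have cf: "plane_claw_free E'"
    unfolding plane_claw_free_def
  proof (intro ballI impI)
    fix a b c assume abc: "a \<in> E'" "b \<in> E'" "c \<in> E'" "a \<noteq> b" "a \<noteq> c" "b \<noteq> c"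
    obtain u v w where uvw: "u \<in> E" "v \<in> E" "w \<in> E" "\<pi> u = a" "\<pi> v = b" "\<pi> w = c"
      using abc unfolding E'_def by blast
    have lift: "\<pi> t \<in> E'" if "t \<in> E" "\<pi> t \<noteq> 0" for t using that by (auto simp: E'_def)
    have "u + v \<in> E \<or> u + w \<in> E \<or> v + w \<in> E \<or> u + v + w \<in> E"
      using E(2) uvw abc unfolding plane_claw_free_def by metis
    \<comment> \<open>A sum of two distinct images is nonzero, so it stays in \<open>E'\<close> once
      its lift is in \<open>E\<close>. The triple sum could vanish only for
      \<open>a + b = c\<close>, but then \<open>a + b\<close> is in \<open>E'\<close>
      anyway.\<close>
    moreover have "a + b + c \<in> E'" if "u + v + w \<in> E" "a + b \<notin> E'"
    proof -
      have "a + b \<noteq> c" using that abc by auto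
      then show ?thesis using lift[OF that(1)] uvw by (simp add: add)
    qed
    ultimately show "a + b \<in> E' \<or> a + c \<in> E' \<or> b + c \<in> E' \<or> a + b + c \<in> E'"
      using lift[of "u + v"] lift[of "u + w"] lift[of "v + w"] uvw abc by (auto simp: add)
  qed
  define fib where "fib c = {v \<in> E. \<pi> v = c}" for c
  have fib: "fib (\<pi> z) = E \<inter> {z, z + x, z + y, z + x + y}" if "z \<in> E" for z
  proof -
    have "\<pi> v = \<pi> z \<longleftrightarrow> v \<in> {z, z + x, z + y, z + x + y}" if "v \<in> E" for v
    proof -
      have "\<pi> v = \<pi> z \<longleftrightarrow> \<pi> (v + z) = 0" by (simp add: add)
      also have "\<dots> \<longleftrightarrow> v + z \<in> {0, x, y, x + y}"
        using ker[of "v + z"] B \<open>z \<in> E\<close> \<open>v \<in> E\<close> span_add by blast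
      also have "\<dots> \<longleftrightarrow> v \<in> {z, z + x, z + y, z + x + y}"
        by (auto simp: add_eq_iff add.assoc)
      finally show ?thesis .
    qed
    then show ?thesis unfolding fib_def by auto
  qed
  \<comment> \<open>Of the four kernel vectors, 0 and \<open>x + y\<close> are not in
    \<open>E\<close>. These two elements give the summand 2 in the count.\<close>
  have fib0: "fib 0 = {x, y}"
    unfolding fib_def using ker xy E B by (auto intro: subsetD)
  have finfib: "finite (fib c)" for c using B by (simp add: fib_def)
  have fibge: "2 \<le> card (fib c)" if c: "c \<in> E'" for c
  proof -
    obtain z where z: "z \<in> E" "\<pi> z = c" "c \<noteq> 0" using c by (auto simp: E'_def)
    have "z \<noteq> x" "z \<noteq> y" using z fib0 xy by (auto simp: fib_def)
    \<comment> \<open>Since \<open>x + y\<close> is missing from \<open>E\<close>, claw-freeness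
      must supply one of the other sums, and each of them lies in the fibre of
      \<open>z\<close>.\<close>
    then have "x + z \<in> E \<or> y + z \<in> E \<or> x + y + z \<in> E"
      using E(2) z xy unfolding plane_claw_free_def by metis
    then have "\<exists>t\<in>{x, y, x + y}. z + t \<in> E" by (simp add: ac_simps)
    then obtain t where t: "t \<in> {x, y, x + y}" "z + t \<in> E" by blast
    have "t \<noteq> 0" using t xy E by auto
    then have "card {z, z + t} = 2" by simp
    moreover have "{z, z + t} \<subseteq> fib c" using t z fib[of z] by (auto simp: add.assoc)
    ultimately show ?thesis using card_mono[OF finfib] by metis
  qed
  have "E = fib 0 \<union> (\<Union>c\<in>E'. fib c)" by (auto simp: fib_def E'_def)
  moreover have "card (fib 0 \<union> (\<Union>c\<in>E'. fib c)) = card (fib 0) + card (\<Union>c\<in>E'. fib c)"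
    using fE' finfib by (intro card_Un_disjoint) (auto simp: fib_def E'_def)
  moreover have "card (\<Union>c\<in>E'. fib c) = (\<Sum>c\<in>E'. card (fib c))"
    using fE' finfib by (intro card_UN_disjoint) (auto simp: fib_def)
  ultimately have cardE: "card E = 2 + (\<Sum>c\<in>E'. card (fib c))"
    using fib0 xy by simp
  have ge: "2 * card E' \<le> (\<Sum>c\<in>E'. card (fib c))"
    using sum_mono[of E' "\<lambda>_. 2" "\<lambda>c. card (fib c)"] fibge by (simp add: mult.commute)
  have eq: "card (E \<inter> {z, z + x, z + y, z + x + y}) = 2"
    if h: "card E = 2 * card E' + 2" and z: "z \<in> E - {x, y}" for z
  proof -
    have "(\<Sum>c\<in>E'. card (fib c)) = (\<Sum>c\<in>E'. 2)" using h cardE by simp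
    then have "\<forall>c\<in>E'. card (fib c) = 2"
      using sum_mono_inv[of "\<lambda>_. 2" E' "\<lambda>c. card (fib c)"] fibge fE' by metis
    moreover have "\<pi> z \<in> E'" using z fib0 by (auto simp: E'_def fib_def)
    ultimately show ?thesis using fib[of z] z by auto
  qed
  show thesis
    by (rule that[of B' E']) (use B' fE' cf cardE ge eq E'_def in auto)
qed

section \<open>The lower bound, by induction on the rank\<close>

lemma closed_span_eq:
  assumes "E \<subseteq> span B" "B \<subseteq> E" "\<And>x y. x \<in> E \<Longrightarrow> y \<in> E \<Longrightarrow> x \<noteq> y \<Longrightarrow> x + y \<in> E"
  shows "span B = insert 0 E"
proof -
  have "x + y \<in> insert 0 E" if "x \<in> insert 0 E" "y \<in> insert 0 E" for x y
    using that assms(3) by (cases "x = y") auto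
  then have "subspace (insert 0 E)" by (auto simp: subspace_bit_iff)
  then show ?thesis using assms by (intro span_subspace) (auto simp: span_zero)
qed

text \<open>A contraction lowers the rank by two, which halves the left side exactly, while
  \<open>card E + 2\<close> is at least twice \<open>card E' + 2\<close>. Adding 2 on the right
  instead of subtracting it on the left avoids truncated subtraction.\<close>

lemma card_plane_claw_free_ge:
  assumes "independent B" "B \<subseteq> E" "E \<subseteq> span B" "finite E" "0 \<notin> E" "plane_claw_free E"
  shows "2 ^ (card B div 2) + 2 ^ ((card B + 1) div 2) \<le> card E + 2"
  using assms
proof (induction "card B" arbitrary: B E rule: less_induct)
  case less
  show ?case
  proof (cases "\<forall>x\<in>E. \<forall>y\<in>E. x \<noteq> y \<longrightarrow> x + y \<in> E")
    case True
    then have "span B = insert 0 E" using less.prems by (intro closed_span_eq) auto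
    then have "2 ^ card B = card E + 1"
      using card_span_independent[of B] less.prems finite_subset[of B E] by simp
    then show ?thesis using balanced_powers_le[of "card B"] by simp
  next
    case False
    then obtain x y where xy: "x \<in> E" "y \<in> E" "x \<noteq> y" "x + y \<notin> E" by blast
    obtain E' B' where "independent B'" "B' \<subseteq> E'" "E' \<subseteq> span B'" "finite E'" "0 \<notin> E'"
      "plane_claw_free E'" and c: "card B = card B' + 2" "2 * card E' + 2 \<le> card E"
      using contraction[OF less.prems xy] by metis
    then have "2 ^ (card B' div 2) + 2 ^ ((card B' + 1) div 2) \<le> card E' + 2"
      using less.hyps[of B' E'] by simp
    then show ?thesis using c balanced_powers_step[of "card B'"] by simp
  qed
qed

section \<open>Structure in the case of equality\<close>

lemma equality_exact:
  assumes B: "independent B" "B \<subseteq> E" "E \<subseteq> span B" "finite E" "0 \<notin> E" "plane_claw_free E"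
    and eq: "card E + 2 = 2 ^ (card B div 2) + 2 ^ ((card B + 1) div 2)"
    and xy: "x \<in> E" "y \<in> E" "x \<noteq> y" "x + y \<notin> E"
    and z: "z \<in> E" "z \<noteq> x" "z \<noteq> y"
  shows "card (E \<inter> {z, z + x, z + y, z + x + y}) = 2"
proof -
  obtain E' B' where E': "independent B'" "B' \<subseteq> E'" "E' \<subseteq> span B'" "finite E'" "0 \<notin> E'"
      "plane_claw_free E'" and c: "card B = card B' + 2" "2 * card E' + 2 \<le> card E"
    and ex: "card E = 2 * card E' + 2 \<Longrightarrow> z \<in> E - {x, y} \<Longrightarrow>
       card (E \<inter> {z, z + x, z + y, z + x + y}) = 2"
    using contraction[OF B xy] by metis
  \<comment> \<open>The lower bound for \<open>E'\<close>, doubled, already reaches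
    \<open>card E + 2\<close>, so the contraction inequality is tight.\<close>
  have "card E = 2 * card E' + 2"
    using card_plane_claw_free_ge[OF E'] eq c balanced_powers_step[of "card B'"] by simp
  then show ?thesis using ex z by simp
qed

text \<open>The assumption \<open>trans\<close> is transitivity of the relation
  \<open>u = v \<or> u + v \<in> E\<close>, and the set is the class of \<open>x\<close>. For
  \<open>u\<close>, \<open>v\<close> in it, transitivity through \<open>x\<close> gives
  \<open>u + v \<in> E\<close>. The sum of \<open>u + v\<close> and \<open>u\<close> is
  \<open>v\<close>, so \<open>u + v\<close> is related to \<open>u\<close> and thus to
  \<open>x\<close>.\<close>

lemma subspace_sum_class:
  assumes trans: "\<And>x y z. x \<in> E \<Longrightarrow> y \<in> E \<Longrightarrow> z \<in> E \<Longrightarrow> x + z \<in> E \<Longrightarrow> y + z \<in> E \<Longrightarrow> x \<noteq> y \<Longrightarrow> x + y \<in> E"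
    and x: "x \<in> E"
  shows "subspace (insert 0 {u \<in> E. u = x \<or> u + x \<in> E})"
proof -
  have "u + v \<in> E \<and> (u + v = x \<or> u + v + x \<in> E)"
    if "u \<in> E" "v \<in> E" "u = x \<or> u + x \<in> E" "v = x \<or> v + x \<in> E" "u \<noteq> v" for u v
  proof -
    have uv: "u + v \<in> E" using that trans[of u v x] x by (auto simp: add.commute)
    consider "u = x" | "v = x" | "u \<noteq> x" "v \<noteq> x" "u + v \<noteq> x" | "u + v = x" by blast
    then show ?thesis
    proof cases
      case 1
      then have "u + v + x = v" by (metis add.commute add_self_left)
      then show ?thesis using uv that(2) by metis
    next
      case 2
      then have "u + v + x = u" by (simp add: add.assoc)
      then show ?thesis using uv that(1) by metis
    next
      case 3
      have "u + v + u = v" by (metis add.commute add_self_left)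
      then have "u + v + x \<in> E"
        using trans[of "u + v" x u] uv that x 3 by (auto simp: add.commute)
      then show ?thesis using uv by simp
    next
      case 4
      then show ?thesis using x by simp
    qed
  qed
  then show ?thesis unfolding subspace_bit_iff
    by auto
qed

text \<open>The cases are three pairwise unrelated elements, or at most two classes of
  \<open>R\<close>. In the latter each class is a flat, and the empty flat stands in for a missing
  class.\<close>

lemma two_flats_or_sum_free:
  assumes cf: "plane_claw_free E"
    and trans: "\<And>x y z. x \<in> E \<Longrightarrow> y \<in> E \<Longrightarrow> z \<in> E \<Longrightarrow> x + z \<in> E \<Longrightarrow> y + z \<in> E \<Longrightarrow> x \<noteq> y \<Longrightarrow> x + y \<in> E"
  shows "(\<exists>F1 F2. E = F1 \<union> F2 \<and> F1 \<inter> F2 = {} \<and> subspace (insert 0 F1) \<and> subspace (insert 0 F2)) \<or>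
    (\<exists>x y z. {x, y, z} \<subseteq> E \<and> distinct [x, y, z] \<and> (\<forall>a\<in>E. \<forall>b\<in>E. a + b \<notin> E))"
proof -
  define R where "R a b \<longleftrightarrow> a = b \<or> a + b \<in> E" for a b
  have R_sym: "R a b \<Longrightarrow> R b a" for a b by (auto simp: R_def add.commute)
  have R_refl: "R a a" for a by (simp add: R_def)
  have R_trans: "R a c" if "a \<in> E" "b \<in> E" "c \<in> E" "R a b" "R b c" for a b c
    using that trans[of a c b] by (auto simp: R_def add.commute)
  have class_subspace: "subspace (insert 0 {u \<in> E. R u x})" if "x \<in> E" for x
    unfolding R_def by (rule subspace_sum_class[OF trans that])
  show ?thesis
  proof (cases "\<exists>x\<in>E. \<exists>y\<in>E. \<exists>z\<in>E. \<not> R x y \<and> \<not> R x z \<and> \<not> R y z")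
    case True
    then obtain x y z where xyz: "x \<in> E" "y \<in> E" "z \<in> E" "\<not> R x y" "\<not> R x z" "\<not> R y z"
      by blast
    have triple: "a + b + c \<in> E"
      if "a \<in> E" "b \<in> E" "c \<in> E" "\<not> R a b" "\<not> R a c" "\<not> R b c" for a b c
      using that cf unfolding plane_claw_free_def R_def by metis
    \<comment> \<open>If \<open>a + w\<close> were in \<open>E\<close>, both \<open>w\<close> and
      \<open>a + w\<close> would be related to \<open>a\<close>. Then \<open>w\<close>, like
      \<open>a\<close>, is unrelated to \<open>b\<close> and \<open>c\<close>, so
      \<open>a + b + c\<close> and \<open>w + b + c\<close> lie in \<open>E\<close>. As they sum to
      \<open>a + w\<close>, the vector \<open>a + b + c\<close> is related to \<open>a + w\<close>,
      hence to \<open>a\<close>, which forces \<open>R b c\<close>.\<close>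
    have singleton: "a + w \<notin> E"
      if a: "a \<in> E" "b \<in> E" "c \<in> E" "\<not> R a b" "\<not> R a c" "\<not> R b c" and w: "w \<in> E" for a b c w
    proof
      assume aw: "a + w \<in> E"
      have "R a w" "R a (a + w)" using aw w by (auto simp: R_def)
      then have "\<not> R w b" "\<not> R w c" using a w R_trans[of a w b] R_trans[of a w c] by metis+
      then have "w + b + c \<in> E" using a w by (intro triple)
      moreover have t: "a + b + c \<in> E" using a by (intro triple)
      moreover have "a + b + c + (a + w) = w + b + c"
        by (metis add.assoc add.commute add_self_left)
      ultimately have "R (a + b + c) (a + w)" unfolding R_def by metis
      then have "R (a + b + c) a" using R_trans[OF t aw a(1)] R_sym[OF \<open>R a (a + w)\<close>] by metis
      moreover have "a + b + c + a = b + c" by (metis add.assoc add.commute add_self_left)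
      ultimately have "a + b + c = a \<or> b + c \<in> E" by (simp add: R_def)
      then show False using a(6) by (auto simp: R_def add.assoc)
    qed
    have "a + b \<notin> E" if "a \<in> E" "b \<in> E" for a b
    proof -
      \<comment> \<open>By transitivity \<open>a\<close> is related to at most one of
        \<open>x\<close>, \<open>y\<close>, \<open>z\<close>; the other two serve.\<close>
      have "\<exists>c\<in>{x,y,z}. \<exists>d\<in>{x,y,z}. \<not> R a c \<and> \<not> R a d \<and> \<not> R c d"
      proof -
        have "\<not> R a d" if "R a c" "\<not> R c d" "c \<in> E" "d \<in> E" for c d
          using R_trans[of c a d] R_sym[OF that(1)] that(2-4) \<open>a \<in> E\<close> by metis
        then show ?thesis using xyz R_sym by (metis insertCI)
      qed
      then obtain c d where "c \<in> E" "d \<in> E" "\<not> R a c" "\<not> R a d" "\<not> R c d" using xyz by auto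
      then show ?thesis using singleton[of a c d b] that by metis
    qed
    moreover have "distinct [x, y, z]" using xyz R_refl by auto
    ultimately show ?thesis
      using xyz by (intro disjI2 exI[of _ x] exI[of _ y] exI[of _ z] conjI ballI) simp_all
  next
    case False
    have two: ?thesis if "E = F1 \<union> F2" "F1 \<inter> F2 = {}" "subspace (insert 0 F1)" "subspace (insert 0 F2)" for F1 F2
      using that by blast
    have s0: "subspace (insert 0 {})" by simp
    show ?thesis
    proof (cases "\<exists>x\<in>E. \<exists>y\<in>E. \<not> R x y")
      case True
      then obtain x y where xy: "x \<in> E" "y \<in> E" "\<not> R x y" by blast
      show ?thesis
      proof (rule two[OF _ _ class_subspace[OF xy(1)] class_subspace[OF xy(2)]])
        have "R u x \<or> R u y" if "u \<in> E" for u using False xy that R_sym by metis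
        then show "E = {u \<in> E. R u x} \<union> {u \<in> E. R u y}" by auto
        have "\<not> (R u x \<and> R u y)" if "u \<in> E" for u using xy that R_sym R_trans by metis
        then show "{u \<in> E. R u x} \<inter> {u \<in> E. R u y} = {}" by auto
      qed
    next
      case R: False
      show ?thesis
      proof (cases "E = {}")
        case True
        then show ?thesis using two[OF _ _ s0 s0] by simp
      next
        case ne: False
        then obtain x where x: "x \<in> E" by blast
        have "E = {u \<in> E. R u x}" using R x by blast
        then show ?thesis using two[OF _ _ class_subspace[OF x] s0] by simp
      qed
    qed
  qed
qed

text \<open>The translate \<open>S = x + E\<close> is a subspace: \<open>(x + u) + (x + v)\<close>
  is \<open>x + (x + u + v)\<close>, and with no sums of pairs in \<open>E\<close>, claw-freeness
  puts \<open>x + u + v\<close> there. Hence \<open>E\<close> is the other coset of \<open>S\<close>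
  in \<open>span E\<close>, that is, half of it.\<close>

lemma card_sum_free:
  assumes E: "0 \<notin> E" "plane_claw_free E" "finite E" "E \<noteq> {}"
    and sf: "\<And>a b. a \<in> E \<Longrightarrow> b \<in> E \<Longrightarrow> a + b \<notin> E"
  shows "card (span E) = 2 * card E"
proof -
  obtain x where x: "x \<in> E" using E by blast
  define S where "S = (+) x ` E"
  have "x + u + (x + v) \<in> S" if "u \<in> E" "v \<in> E" for u v
  proof -
    have eq: "x + u + (x + v) = x + (x + u + v)" by (metis add.assoc add.commute)
    have "x + u + v \<in> E"
    \<comment> \<open>If two of the three vectors coincide, they cancel and leave the third.\<close>
    proof (cases "x = u \<or> x = v \<or> u = v")
      case True
      then show ?thesis using that x by (auto simp: add.assoc) (metis add.commute add_self_left)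
    next
      case False
      then show ?thesis using E(2) that x sf unfolding plane_claw_free_def by metis
    qed
    then show ?thesis unfolding eq S_def by blast
  qed
  then have S: "subspace S" using x unfolding subspace_bit_iff S_def
    by (auto simp: image_iff intro: bexI[of _ x])
  have "E = (+) x ` S" unfolding S_def by (auto simp: image_image)
  then have "span (insert x S) = S \<union> E" using S by (simp add: span_insert_bit span_eq_iff[THEN iffD2])
  moreover have "span (insert x S) = span E"
  proof (rule span_unique[symmetric])
    show "E \<subseteq> span (insert x S)" using calculation by blast
    show "span (insert x S) \<subseteq> T" if "E \<subseteq> T" "subspace T" for T
    proof (rule span_minimal[OF _ that(2)])
      show "insert x S \<subseteq> T" using that x subspace_add[OF that(2)] by (auto simp: S_def)
    qed
  qed simp
  moreover have "S \<inter> E = {}" using sf x by (auto simp: S_def)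
  moreover have "card S = card E" unfolding S_def by (rule card_image) (auto intro: inj_onI)
  moreover have "finite S" using E by (simp add: S_def)
  ultimately show ?thesis using E(3) card_Un_disjoint[of S E] by simp
qed

text \<open>The two subspaces meet only in 0, so addition is injective on their product. Comparing
  sizes as powers of two gives the dimensions.\<close>

lemma dims_two_flats:
  assumes F: "subspace (insert 0 F1)" "subspace (insert 0 F2)" "F1 \<inter> F2 = {}"
    "0 \<notin> F1" "0 \<notin> F2" "finite F1" "finite F2"
  shows "dim (span (F1 \<union> F2)) = dim (insert 0 F1) + dim (insert 0 F2)"
proof -
  let ?f = "\<lambda>(u, v). u + v" and ?A = "insert 0 F1" and ?B = "insert 0 F2"
  have "inj_on ?f (?A \<times> ?B)"
  proof (rule inj_onI, clarify)
    fix u v u' v' assume uv: "u \<in> ?A" "v \<in> ?B" "u' \<in> ?A" "v' \<in> ?B" "u + v = u' + v'"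
    have "u + u' = v + v'" using uv(5) by (metis add.assoc add.commute add_self_left)
    moreover have "u + u' \<in> ?A" "v + v' \<in> ?B" using uv F(1,2) subspace_add by blast+
    ultimately have "u + u' = 0" using F(3) by auto
    then show "u = u' \<and> v = v'" using \<open>u + u' = v + v'\<close> by simp
  qed
  then have "card (?f ` (?A \<times> ?B)) = card ?A * card ?B" by (simp only: card_image card_cartesian_product)
  moreover have sp: "span (F1 \<union> F2) = ?f ` (?A \<times> ?B)"
  proof -
    have "span (F1 \<union> F2) = span (?A \<union> ?B)" by (metis Un_insert_left Un_insert_right span_insert_0)
    also have "\<dots> = ?f ` (span ?A \<times> span ?B)" unfolding span_Un by force
    finally show ?thesis using F(1,2) by (simp only: span_eq_iff[THEN iffD2])
  qed
  moreover have "card (span (F1 \<union> F2)) = 2 ^ dim (span (F1 \<union> F2))"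
  proof (rule card_subspace)
    show "finite (span (F1 \<union> F2))" unfolding sp using F(6,7) by (intro finite_imageI) simp
  qed simp
  moreover have "card ?A = 2 ^ dim ?A" "card ?B = 2 ^ dim ?B"
    by (rule card_subspace; use F in simp)+
  ultimately have "(2::nat) ^ dim (span (F1 \<union> F2)) = 2 ^ (dim ?A + dim ?B)"
    unfolding power_add by metis
  then show ?thesis by simp
qed

end

section \<open>The three-dimensional space containing \<open>C4\<close>\<close>

lemma bit3_expand: "v = v $ 1 *s axis 1 1 + v $ 2 *s axis 2 1 + v $ 3 *s axis 3 (1::bit)"
  for v :: "bit ^ 3"
  by (simp add: vec_eq_iff forall_3 axis_def)

lemma UNIV_bit3: "(UNIV :: (bit ^ 3) set) = vec.span {axis 1 1, axis 2 1, axis 3 1}"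
proof -
  have "v \<in> vec.span {axis 1 1, axis 2 1, axis 3 1}" for v :: "bit ^ 3"
    by (subst bit3_expand) (intro vec.span_add vec.span_scale vec.span_base; simp)
  then show ?thesis by blast
qed

lemma bit_vector_space_bit3: "bit_vector_space ((*s) :: bit \<Rightarrow> bit ^ 3 \<Rightarrow> bit ^ 3)"
  by (intro bit_vector_space.intro vec.vector_space_axioms)

lemma independent_axes_bit3: "vec.independent {axis 1 1, axis 2 1, axis 3 1 :: bit ^ 3}"
  by (rule vec.independent_mono[OF vec.independent_Basis]) (auto simp: cart_basis_def)

lemma card_axes_bit3: "card {axis 1 1, axis 2 1, axis 3 1 :: bit ^ 3} = 3"
  by (simp add: axis_eq_axis)

lemma card_bit3: "card (UNIV :: (bit ^ 3) set) = 8"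
  using bit_vector_space.card_span_independent[OF bit_vector_space_bit3 _ independent_axes_bit3]
  unfolding UNIV_bit3 card_axes_bit3 by simp

lemma card_C4: "card (fst C4) = 4"
proof -
  define s :: "bit ^ 3" where "s = axis 1 1 + axis 2 1 + axis 3 (1::bit)"
  \<comment> \<open>The fourth vector has all coordinates 1, while each unit vector has a coordinate
    0.\<close>
  have "s $ 1 = 1" "s $ 2 = 1" "s $ 3 = 1" by (simp_all add: s_def axis_def)
  moreover have "axis 1 (1::bit) $ (2::3) = 0" "axis 2 (1::bit) $ (1::3) = 0" "axis 3 (1::bit) $ (1::3) = 0"
    by (simp_all add: axis_def)
  ultimately have "s \<noteq> axis 1 1" "s \<noteq> axis 2 1" "s \<noteq> axis 3 1" by (metis zero_neq_one)+
  then show ?thesis by (auto simp: C4_def axis_eq_axis simp flip: s_def)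
qed

section \<open>Isomorphism with \<open>C4\<close>, claws, and the extremal sets\<close>

context bit_vector_space
begin

text \<open>The linear map taking the basis to the unit vectors is onto; both spaces have eight
  elements, so it is also injective.\<close>

lemma isomorphic_C4:
  assumes ind: "independent {x, y, z}" and d: "distinct [x, y, z]"
    and span: "span {x, y, z} = insert 0 G" and E: "E = {x, y, z, x + y + z}"
  shows "isomorphic smul (*s) (E, G) C4"
proof -
  interpret P: vector_space_pair smul "(*s) :: bit \<Rightarrow> bit ^ 3 \<Rightarrow> bit ^ 3" by unfold_locales
  define g :: "'v \<Rightarrow> bit ^ 3"
    where "g u = (if u = x then axis 1 1 else if u = y then axis 2 1 else axis 3 1)" for u
  obtain f where lin: "Vector_Spaces.linear smul (*s) f" and fg: "\<And>u. u \<in> {x, y, z} \<Longrightarrow> f u = g u"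
    using P.linear_independent_extend[OF ind, of g] by auto
  have f: "f x = axis 1 1" "f y = axis 2 1" "f z = axis 3 1" using fg d by (auto simp: g_def)
  have "f ` span {x, y, z} = vec.span (f ` {x, y, z})" by (rule P.linear_span_image[OF lin, symmetric])
  also have "\<dots> = UNIV" using f UNIV_bit3 by simp
  finally have im: "f ` insert 0 G = UNIV" using span by simp
  have "card {x, y, z} = 3" using d by simp
  then have "finite (insert 0 G)" "card (insert 0 G) = 8"
    using card_span_independent[OF _ ind] span by simp_all
  then have "inj_on f (insert 0 G)" using im card_bit3 by (intro eq_card_imp_inj_on) simp_all
  then have "bij_betw f (G \<union> {0}) UNIV" using im by (simp add: bij_betw_def)
  moreover have "f ` E = {axis 1 1, axis 2 1, axis 3 1, axis 1 1 + axis 2 1 + axis 3 1}"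
    using f by (simp add: E P.linear_add[OF lin])
  ultimately show ?thesis
    unfolding C4_def isomorphic.simps linear_iso_on_def
    by (auto intro!: exI[of _ f] simp: P.linear_0[OF lin] P.linear_add[OF lin] P.linear_scale[OF lin])
qed

lemma plane_claw_free_if_claw_free:
  assumes cf: "claw_free smul (E, G)" and M: "is_matroid smul (E, G)"
  shows "plane_claw_free E"
  unfolding plane_claw_free_def
proof (intro ballI impI, rule ccontr)
  fix x y z assume xyz: "x \<in> E" "y \<in> E" "z \<in> E" "x \<noteq> y" "x \<noteq> z" "y \<noteq> z"
    and no: "\<not> (x + y \<in> E \<or> x + z \<in> E \<or> y + z \<in> E \<or> x + y + z \<in> E)"
  have G: "0 \<notin> G" "subspace (insert 0 G)" "E \<subseteq> G" using M by auto
  define F where "F = span {x, y, z} - {0}"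
  have F0: "F \<union> {0} = span {x, y, z}" using span_zero by (auto simp: F_def)
  \<comment> \<open>The only possible linear relation among three distinct nonzero vectors is that
    they sum to 0.\<close>
  have "x + y \<noteq> z" using xyz no by auto
  then have ind: "independent {x, y, z}" using xyz G
    by (auto simp: independent_insert span_pair span_insert_bit add_eq_iff)
  have "span {x, y, z} \<subseteq> insert 0 G" using xyz G by (intro span_minimal) auto
  then have flat: "is_flat smul G F" unfolding is_flat_def F0 by (auto simp: F_def)
  have EF: "E \<inter> F = {x, y, z}" using xyz no G by (auto simp: F_def span_triple)
  have "dim (span {x, y, z}) = 3"
    using xyz dim_span_eq_card_independent[OF ind] by simp
  then have "is_claw smul ({x, y, z}, F)"
    using ind EF F0 by (auto simp: flat_dim_def F_def intro!: exI[of _ "{x, y, z}"])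
  moreover have "isomorphic smul smul (restriction (E, G) F) ({x, y, z}, F)"
    unfolding restriction.simps isomorphic.simps EF
    by (rule exI[of _ id]) (simp add: linear_iso_on_def)
  ultimately show False using cf flat unfolding claw_free.simps by blast
qed

lemma card_two_flats:
  assumes "subspace (insert 0 F1)" "subspace (insert 0 F2)" "F1 \<inter> F2 = {}"
    "0 \<notin> F1" "0 \<notin> F2" "finite F1" "finite F2"
  shows "card (F1 \<union> F2) + 2 = 2 ^ dim (insert 0 F1) + 2 ^ dim (insert 0 F2)"
proof -
  have "card F1 + 1 = 2 ^ dim (insert 0 F1)" "card F2 + 1 = 2 ^ dim (insert 0 F2)"
    using card_subspace[OF assms(1)] card_subspace[OF assms(2)] assms by simp_all
  then show ?thesis using assms card_Un_disjoint[of F1 F2] by simp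
qed

lemma equality_cases:
  assumes E: "finite E" "0 \<notin> E" "plane_claw_free E" "span E = insert 0 G"
    and eq: "card E + 2 = 2 ^ (dim (span E) div 2) + 2 ^ ((dim (span E) + 1) div 2)"
  shows "isomorphic smul (*s) (E, G) C4 \<or>
    (\<exists>F1 F2. subspace (insert 0 F1) \<and> subspace (insert 0 F2) \<and> F1 \<inter> F2 = {} \<and> E = F1 \<union> F2 \<and>
      dim (insert 0 F1) = dim (span E) div 2 \<and> dim (insert 0 F2) = (dim (span E) + 1) div 2)"
proof -
  define r where "r = dim (span E)"
  obtain B where B: "B \<subseteq> E" "independent B" "E \<subseteq> span B" "card B = dim E"
    using basis_exists .
  have r: "card B = r" using B by (simp add: r_def)
  have trans: "x + y \<in> E"
    if h: "x \<in> E" "y \<in> E" "z \<in> E" "x + z \<in> E" "y + z \<in> E" "x \<noteq> y" for x y z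
  proof (rule ccontr)
    assume n: "x + y \<notin> E"
    have "z \<noteq> x" "z \<noteq> y" using h E(2) by auto
    then have "card (E \<inter> {z, z + x, z + y, z + x + y}) = 2"
      using equality_exact[OF B(2,1,3) E(1-3) _ h(1,2,6) n h(3)] eq r r_def by simp
    \<comment> \<open>If transitivity failed, the fibre of \<open>z\<close> would hold three
      elements instead of two.\<close>
    moreover have "{z, z + x, z + y} \<subseteq> E \<inter> {z, z + x, z + y, z + x + y}"
      using h by (auto simp: add.commute)
    moreover have "card {z, z + x, z + y} = 3"
    proof -
      have "x \<noteq> 0" "y \<noteq> 0" using h E(2) by auto
      then show ?thesis using h(6) by simp
    qed
    ultimately show False
      using card_mono[of "E \<inter> {z, z + x, z + y, z + x + y}" "{z, z + x, z + y}"] E(1) by simp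
  qed
  have "(\<exists>F1 F2. E = F1 \<union> F2 \<and> F1 \<inter> F2 = {} \<and> subspace (insert 0 F1) \<and> subspace (insert 0 F2)) \<or>
    (\<exists>x y z. {x, y, z} \<subseteq> E \<and> distinct [x, y, z] \<and> (\<forall>a\<in>E. \<forall>b\<in>E. a + b \<notin> E))"
    using E(3) trans by (rule two_flats_or_sum_free)
  then show ?thesis
  proof (elim disjE exE conjE)
    fix F1 F2 assume F: "E = F1 \<union> F2" "F1 \<inter> F2 = {}" "subspace (insert 0 F1)" "subspace (insert 0 F2)"
    have fin: "0 \<notin> F1" "0 \<notin> F2" "finite F1" "finite F2" using E F by auto
    have "dim (insert 0 F1) + dim (insert 0 F2) = r"
      using dims_two_flats[OF F(3,4,2) fin] F(1) r_def by simp
    moreover have "2 ^ dim (insert 0 F1) + 2 ^ dim (insert 0 F2) = (2 ^ (r div 2) + 2 ^ ((r + 1) div 2) :: nat)"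
      using card_two_flats[OF F(3,4,2) fin] eq F(1) r_def by simp
    ultimately have "dim (insert 0 F1) = r div 2 \<and> dim (insert 0 F2) = (r + 1) div 2 \<or>
        dim (insert 0 F2) = r div 2 \<and> dim (insert 0 F1) = (r + 1) div 2"
      by (rule powers_sum_balanced)
    \<comment> \<open>If the dimensions come in the opposite order, the two flats are
      exchanged.\<close>
    then show ?thesis unfolding r_def using F by (metis Int_commute Un_commute)
  next
    fix x y z assume xyz: "{x, y, z} \<subseteq> E" "distinct [x, y, z]" and sf: "\<forall>a\<in>E. \<forall>b\<in>E. a + b \<notin> E"
    have "x + y \<noteq> z" using xyz sf by auto
    then have ind: "independent {x, y, z}" using xyz E(2)
      by (auto simp: independent_insert span_pair span_insert_bit add_eq_iff)
    have t: "x + y + z \<in> E" using E(3) xyz sf unfolding plane_claw_free_def by auto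
    have sub: "{x, y, z, x + y + z} \<subseteq> E" using xyz t by simp
    have c4: "card {x, y, z, x + y + z} = 4"
    proof -
      have "x + y + z \<noteq> x" using xyz by (simp add: add.assoc)
      moreover have "x + y + z \<noteq> y" using xyz by (metis add_eq_iff add_self_left add.commute distinct_length_2_or_more)
      moreover have "x + y + z \<noteq> z" using xyz by (simp add: add.commute[of _ z] add_eq_iff)
      ultimately show ?thesis using xyz by auto
    qed
    have "card (span E) = 2 * card E" using E sf xyz by (intro card_sum_free) auto
    moreover have "card (span E) = 2 ^ r"
    proof -
      have "finite B" using B(1) E(1) finite_subset by blast
      moreover have "span B = span E" using B by (meson span_eq span_superset subset_trans)
      ultimately show ?thesis using card_span_independent[OF _ B(2)] r by simp
    qed
    ultimately have ce: "2 * card E = 2 ^ r" by simp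
    \<comment> \<open>The two powers \<open>p\<close>, \<open>q\<close> have product
      \<open>2 ^ r\<close>, which is twice \<open>card E\<close>, and sum \<open>card E + 2\<close>.
      So \<open>(p - 2) * (q - 2) = 0\<close>, one exponent is 1, and \<open>r \<le> 3\<close>
      bounds \<open>card E\<close> by 4. The four vectors already found then exhaust
      \<open>E\<close>.\<close>
    have "card E = 4"
    proof -
      define p q :: int where "p = 2 ^ (r div 2)" and "q = 2 ^ ((r + 1) div 2)"
      have "int (2 ^ (r div 2) * 2 ^ ((r + 1) div 2)) = int (2 * card E)"
        unfolding ce balanced_powers_mult ..
      then have m: "p * q = 2 * int (card E)" by (simp add: p_def q_def)
      have "int (card E + 2) = int (2 ^ (r div 2) + 2 ^ ((r + 1) div 2))" using eq r_def by simp
      then have s: "int (card E) + 2 = p + q" by (simp add: p_def q_def)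
      have "(p - 2) * (q - 2) = p * q - 2 * (p + q) + 4" by (simp add: algebra_simps)
      also have "\<dots> = 0" using m s by simp
      finally have "p = 2 ^ 1 \<or> q = 2 ^ 1" by simp
      then have "r div 2 = 1 \<or> (r + 1) div 2 = 1" unfolding p_def q_def
        by (simp only: power_inject_exp one_less_numeral_iff semiring_norm)
      then have "r \<le> 3" by linarith
      then have "(2::nat) ^ r \<le> 2 ^ 3" by (intro power_increasing) auto
      then have "card E \<le> 4" using ce by simp
      moreover have "4 \<le> card E" using card_mono[OF E(1) sub] c4 by simp
      ultimately show ?thesis by simp
    qed
    then have Eeq: "E = {x, y, z, x + y + z}" using card_subset_eq[OF E(1) sub] c4 by simp
    have "span {x, y, z} = span E"
    proof -
      have "x + y + z \<in> span {x, y, z}" by (simp add: span_triple)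
      then have "E \<subseteq> span {x, y, z}" unfolding Eeq by (auto intro: span_base)
      then show ?thesis using xyz(1) by (meson span_eq span_superset subset_trans)
    qed
    then show ?thesis using isomorphic_C4[OF ind xyz(2) _ Eeq] E(4) by simp
  qed
qed

end

section \<open>The bound and its equality cases for matroids\<close>

theorem theorem1p8:
  fixes smul :: "bit \<Rightarrow> 'v::ab_group_add \<Rightarrow> 'v"
    and E G :: "'v set"
    and r :: nat
  assumes "vector_space smul"
    and "is_matroid smul (E, G)"
    and "matroid_dim smul (E, G) = r"
    and "full_rank smul (E, G)"
    and "claw_free smul (E, G)"
  shows "card E \<ge> 2 ^ (r div 2) + 2 ^ ((r + 1) div 2) - 2 \<and>
    (card E = 2 ^ (r div 2) + 2 ^ ((r + 1) div 2) - 2 \<longleftrightarrow>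
       isomorphic smul (*s) (E, G) C4 \<or>
       (\<exists>F1 F2. is_flat smul G F1 \<and> is_flat smul G F2 \<and>
          F1 \<inter> F2 = {} \<and> E = F1 \<union> F2 \<and>
          flat_dim smul F1 = r div 2 \<and> flat_dim smul F2 = (r + 1) div 2))"
proof -
  interpret bit_vector_space smul using assms(1) by (rule bit_vector_space.intro)
  have G: "0 \<notin> G" "subspace (insert 0 G)" "E \<subseteq> G" and sp: "span E = insert 0 G"
    and r: "dim (insert 0 G) = r"
    using assms by (auto simp: flat_dim_def)
  \<comment> \<open>\<open>dim\<close> is a natural number for infinite-dimensional spaces too, so
    finiteness has to come from the finite spanning set.\<close>
  have fG: "finite (insert 0 G)"
  proof -
    obtain S where S: "finite S" "span S = insert 0 G" using assms(2) by auto
    obtain B where B: "B \<subseteq> S" "independent B" "S \<subseteq> span B" "card B = dim S"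
      using basis_exists .
    have "span B = span S" using B by (meson span_eq span_superset subset_trans)
    moreover have "finite B" using B(1) S(1) finite_subset by blast
    ultimately show ?thesis using card_span_independent[OF _ B(2)] S(2) by simp
  qed
  have E: "finite E" "0 \<notin> E" using G fG finite_subset by auto
  have cf: "plane_claw_free E" using assms by (intro plane_claw_free_if_claw_free)
  have dimE: "dim E = r" using r sp by (metis dim_span)
  obtain B where B: "B \<subseteq> E" "independent B" "E \<subseteq> span B" "card B = dim E"
    using basis_exists .
  have ge: "2 ^ (r div 2) + 2 ^ ((r + 1) div 2) \<le> card E + 2"
    using card_plane_claw_free_ge[OF B(2,1,3) E cf] B(4) dimE by simp
  \<comment> \<open>Hence subtracting 2 in the statement does not truncate, and the equality may be
    treated with 2 added to \<open>card E\<close>.\<close>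
  have one: "(1::nat) \<le> 2 ^ (r div 2)" "(1::nat) \<le> 2 ^ ((r + 1) div 2)" by simp_all
  have flat: "is_flat smul G F \<longleftrightarrow> F \<subseteq> G \<and> subspace (insert 0 F)" for F
    by (simp add: is_flat_def)
  have iff: "card E + 2 = 2 ^ (r div 2) + 2 ^ ((r + 1) div 2) \<longleftrightarrow>
       isomorphic smul (*s) (E, G) C4 \<or>
       (\<exists>F1 F2. is_flat smul G F1 \<and> is_flat smul G F2 \<and>
          F1 \<inter> F2 = {} \<and> E = F1 \<union> F2 \<and>
          flat_dim smul F1 = r div 2 \<and> flat_dim smul F2 = (r + 1) div 2)"
    (is "?eq \<longleftrightarrow> ?iso \<or> ?flats")
  proof (intro iffI; (elim disjE exE conjE)?)
    assume ?eq
    then have "?iso \<or> (\<exists>F1 F2. subspace (insert 0 F1) \<and> subspace (insert 0 F2) \<and> F1 \<inter> F2 = {} \<and>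
      E = F1 \<union> F2 \<and> dim (insert 0 F1) = r div 2 \<and> dim (insert 0 F2) = (r + 1) div 2)"
      using equality_cases[OF E cf sp] dimE by simp
    moreover have ?flats if "subspace (insert 0 F1)" "subspace (insert 0 F2)" "F1 \<inter> F2 = {}"
      "E = F1 \<union> F2" "dim (insert 0 F1) = r div 2" "dim (insert 0 F2) = (r + 1) div 2" for F1 F2
      using that G(3) by (intro exI[of _ F1] exI[of _ F2]) (simp add: flat flat_dim_def)
    ultimately show "?iso \<or> ?flats" by blast
  next
    assume ?iso
    then obtain f where f: "bij_betw f (insert 0 G) (insert 0 (UNIV - {0}) :: (bit ^ 3) set)" "f ` E = fst C4"
      by (auto simp: C4_def linear_iso_on_def)
    \<comment> \<open>Comparing ambient sizes gives \<open>r = 3\<close>, where the bound is 2 + 4 -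
      2 = 4, the size of \<open>C4\<close>.\<close>
    have "card (insert 0 G) = 8" using bij_betw_same_card[OF f(1)] card_bit3 by (simp add: insert_absorb)
    then have "2 ^ r = (2 ^ 3 :: nat)" using card_subspace[OF G(2) fG] r by simp
    then have "r = 3" by (simp only: power_inject_exp one_less_numeral_iff semiring_norm)
    moreover have "card E = 4"
    proof -
      have "inj_on f E" using f(1) G(3) by (auto simp: bij_betw_def intro: inj_on_subset)
      then show ?thesis using card_image f(2) card_C4 by metis
    qed
    ultimately show ?eq by simp
  next
    fix F1 F2 assume F: "is_flat smul G F1" "is_flat smul G F2" "F1 \<inter> F2 = {}" "E = F1 \<union> F2"
      "flat_dim smul F1 = r div 2" "flat_dim smul F2 = (r + 1) div 2"
    have "0 \<notin> F1" "0 \<notin> F2" "finite F1" "finite F2" using E F(4) by auto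
    then show ?eq using card_two_flats[of F1 F2] F by (simp add: flat flat_dim_def)
  qed
  have "card E = 2 ^ (r div 2) + 2 ^ ((r + 1) div 2) - 2 \<longleftrightarrow>
      card E + 2 = 2 ^ (r div 2) + 2 ^ ((r + 1) div 2)"
    using one by linarith
  then show ?thesis using ge unfolding iff by (intro conjI) linarith
qed

end
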